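(* For every $n\ge1$, the total semiperimeter $s(n)=\sum_{w\in\mathcal{M}_n}\mathrm{sper}(w)$ over all Motzkin polyominoes of length $n$ is given by $$s(n)=T_n + 2T_{n-1} - m_{n-1},$$ where $T_n$ is the $n$-th central trinomial coefficient and $m_n$ is the $n$-th Motzkin number.
   Context: A Motzkin word of length $n\ge 1$ is a word $w=w_1\cdots w_n$ over the positive integers such that $w_1=1$, and $1\le w_k\le w_{k-1}+1$ and $w_{k-1}\ne w_k$ for $k=2,\dots,n$; $\mathcal{M}_n$ is the set of Motzkin words of length $n$. To $w$ one associates the Motzkin polyomino $P(w)$ of length $n$ with $n$ columns, all bottom-justified, whose $i$-th column consists of $w_i$ unit cells. The perimeter of $P(w)$ is the number of (unit) cell borders that do not touch another cell of $P(w)$, and the semiperimeter $\mathrm{sper}(w)$ is half of the perimeter. The central trinomial coefficient $T_n$ ($n\ge0$) is the coefficient of $x^n$ in $(1+x+x^2)^n$. The Motzkin numbers $m_n$ are defined by $\sum_{n\ge0}m_nx^n=\frac{1-x-\sqrt{1-2x-3x^2}}{2x^2}$. *)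

theory Defs
  imports
    "HOL-Computational_Algebra.Computational_Algebra"
    Complex_Main
begin

text \<open>
  A word is a list of natural numbers. The list is indexed from 0, so that \<open>w ! k\<close> is the letter
  usually written \<open>w\<^sub>k\<^sub>+\<^sub>1\<close>.
\<close>

definition motzkin_words :: "nat \<Rightarrow> nat list set" where
  "motzkin_words n =
    {w. length w = n \<and> w \<noteq> [] \<and> w ! 0 = 1 \<and>
        (\<forall>k\<in>{1..<n}. 1 \<le> w ! k \<and> w ! k \<le> w ! (k - 1) + 1 \<and> w ! (k - 1) \<noteq> w ! k)}"

text \<open>
  A unit cell is identified with its (column, row) position. The positions are integers because
  every cell has to have four neighbouring positions, also below the bottom row and left of the
  first column.
\<close>

definition motzkin_polyomino :: "nat list \<Rightarrow> (int \<times> int) set" where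
  "motzkin_polyomino w =
    {(int k, j) | k j. k < length w \<and> 1 \<le> j \<and> j \<le> int (w ! k)}"

definition adjacent :: "int \<times> int \<Rightarrow> int \<times> int \<Rightarrow> bool" where
  "adjacent c d \<longleftrightarrow> \<bar>fst c - fst d\<bar> + \<bar>snd c - snd d\<bar> = 1"

text \<open>
  The four borders of a cell \<open>c\<close> correspond to its four adjacent positions \<open>d\<close>, and a border does
  not touch another cell of the polyomino iff \<open>d\<close> is not a cell of it. Such a border belongs to
  exactly one cell of the polyomino, so it is counted once.
\<close>

definition perimeter :: "(int \<times> int) set \<Rightarrow> nat" where
  "perimeter P = card {(c, d). c \<in> P \<and> adjacent c d \<and> d \<notin> P}"

definition sper :: "nat list \<Rightarrow> real" where
  "sper w = real (perimeter (motzkin_polyomino w)) / 2"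

definition total_sper :: "nat \<Rightarrow> real" where
  "total_sper n = (\<Sum>w\<in>motzkin_words n. sper w)"

definition central_trinomial :: "nat \<Rightarrow> nat" where
  "central_trinomial n = coeff ([:1, 1, 1:] ^ n) n"

text \<open>
  The square root is the one with constant term \<open>root 2 1 = 1\<close>. With this choice the numerator is
  divisible by \<open>fps_X\<^sup>2\<close>, so the division below is exact.
\<close>

definition motzkin_number :: "nat \<Rightarrow> real" where
  "motzkin_number n =
    fps_nth ((1 - fps_X - fps_radical root 2 (1 - 2 * fps_X - 3 * fps_X ^ 2)) / (2 * fps_X ^ 2)) n"

end

theory Submission
  imports Defs
begin

text \<open>
  The proof is by generating functions. Bottom and top borders contribute two units of perimeter
  per column; the vertical borders on the left of a column are as many as the units by which it
  exceeds its left neighbour, and since the profile starts and ends at height 0, there are as many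
  borders on the right as on the left. So the semiperimeter of a word is its length plus the total
  of its ascents (\<open>perimeter_eq\<close>), which is additive when a word is cut, up to the ascents at the
  ends of the pieces.

  A Motzkin word is \<open>1\<close>, or \<open>1\<close> followed by a raised Motzkin word \<open>u\<close>, or \<open>1\<close> followed by a
  raised word \<open>u\<close> and a second word \<open>v\<close>: cut the word at its next return to height 1, where
  \<open>u\<close> cannot be empty because equal neighbours are forbidden (\<open>motzkin_words_Suc\<close>). The
  semiperimeters of the three shapes are \<open>2\<close>, \<open>sper u + 2\<close> and \<open>sper u + sper v + 1\<close>. For the
  generating functions \<open>M\<close> of the numbers of words and \<open>S\<close> of the total semiperimeters this
  gives \<open>M = x (1 + M + M\<^sup>2)\<close> and \<open>S = x (2 + S + 2 M + M\<^sup>2 + 2 S M)\<close>.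

  Put \<open>R = 1 - x - 2 x M\<close>. The first equation says \<open>R\<^sup>2 = 1 - 2 x - 3 x\<^sup>2\<close>, so \<open>R\<close> is the square
  root in the definition of the Motzkin numbers, and \<open>M\<close> is their generating function shifted by
  one. The second one is linear in \<open>S\<close> and becomes \<open>S R = M + x + x M\<close>. Finally the generating
  function \<open>T\<close> of the central trinomial coefficients is \<open>1 / R\<close>: a three-term recurrence for the
  coefficients is the differential equation \<open>T' R\<^sup>2 = (1 + 3 x) T\<close>, whence \<open>T\<^sup>2 R\<^sup>2\<close> has derivative
  0. Eliminating \<open>R\<close> yields \<open>S = T - 1 + 2 x T - M\<close>, and the theorem is the coefficient of
  \<open>x\<^sup>n\<close>, to which the summand \<open>-1\<close> contributes only for \<open>n = 0\<close>.
\<close>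

section \<open>The semiperimeter as length plus ascents\<close>

text \<open>
  The argument \<open>p\<close> is the height of the column before the list, so that ascents across the
  boundary of two pieces can be counted when a word is cut. Subtraction on the naturals makes
  descents contribute 0.
\<close>

fun ascent_sum :: "nat \<Rightarrow> nat list \<Rightarrow> nat" where
  "ascent_sum p [] = 0"
| "ascent_sum p (x # xs) = (x - p) + ascent_sum x xs"

text \<open>
  The columns are indexed by integers, with height 0 outside the polyomino, so that the first and
  the last column need no separate treatment.
\<close>

definition column_height :: "nat list \<Rightarrow> int \<Rightarrow> int" where
  "column_height w x = (if 0 \<le> x \<and> x < int (length w) then int (w ! nat x) else 0)"

lemma polyomino_column_height:
  "motzkin_polyomino w = {(x, y). 1 \<le> y \<and> y \<le> column_height w x}"
proof -
  have "(x, y) \<in> motzkin_polyomino w \<longleftrightarrow> 1 \<le> y \<and> y \<le> column_height w x" for x y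
    unfolding motzkin_polyomino_def column_height_def
    by (auto intro!: exI[of _ "nat x"])
  then show ?thesis by auto
qed

lemma adjacent_iff:
  "adjacent (x, y) d \<longleftrightarrow> d = (x, y + 1) \<or> d = (x, y - 1) \<or> d = (x - 1, y) \<or> d = (x + 1, y)"
  by (cases d) (auto simp: adjacent_def)

lemma ascent_sum_eq_sum:
  "ascent_sum p w = (\<Sum>k<length w. w ! k - (p # w) ! k)"
  by (induction w arbitrary: p) (simp_all add: sum.lessThan_Suc_shift del: sum.lessThan_Suc)

text \<open>
  The difference of the two sums of truncated differences is a telescoping sum.
\<close>

lemma sum_ascents_eq_sum_descents:
  fixes g :: "nat \<Rightarrow> nat"
  shows "(\<Sum>k<m. g (Suc k) - g k) + g 0 = (\<Sum>k<m. g k - g (Suc k)) + g m"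
  by (induction m) auto

text \<open>
  The exposed borders are counted by direction. Each column has one top and one bottom border; it
  has a left border in exactly those rows that exceed the height of the column to the left, and
  similarly on the right. The right borders are as many as the left ones by
  \<open>sum_ascents_eq_sum_descents\<close>.
\<close>

lemma perimeter_eq:
  assumes pos: "\<forall>x\<in>set w. 1 \<le> x"
  shows "perimeter (motzkin_polyomino w) = 2 * (length w + ascent_sum 0 w)"
proof -
  define n where "n = length w"
  define h where "h = column_height w"
  \<comment> \<open>The profile padded with height 0 at both ends, indexed by naturals: column \<open>k\<close> has height \<open>g (Suc k)\<close>.\<close>
  define g where "g = (\<lambda>k. (0 # w @ [0]) ! k)"
  have h_pos: "1 \<le> h (int k)" if "k < n" for k
    using that pos by (auto simp: h_def column_height_def n_def)
  have h_range: "\<exists>k<n. x = int k" if "1 \<le> h x" for x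
    using that by (auto simp: h_def column_height_def n_def split: if_splits intro!: exI[of _ "nat x"])
  have hg: "h (int k) = int (g (Suc k))" if "k < n" for k
    using that by (auto simp: h_def column_height_def n_def g_def nth_append)
  have hg_left: "h (int k - 1) = int (g k)" if "k < n" for k
    using that
    by (cases k) (auto simp: h_def column_height_def n_def g_def nth_append)
  have hg_right: "h (int k + 1) = int (g (Suc (Suc k)))" if "k < n" for k
  proof -
    have *: "nat (int k + 1) = Suc k" by simp
    show ?thesis using that
      by (auto simp: h_def column_height_def n_def g_def nth_append * not_less)
  qed
  define top where "top = (\<lambda>k. ((int k, h (int k)), (int k, h (int k) + 1))) ` {..<n}"
  define bottom where "bottom = (\<lambda>k. ((int k, 1 :: int), (int k, 0 :: int))) ` {..<n}"
  define left where "left = (\<lambda>(k, y). ((int k, y), (int k - 1, y))) `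
    (SIGMA k:{..<n}. {h (int k - 1)<..h (int k)})"
  define right where "right = (\<lambda>(k, y). ((int k, y), (int k + 1, y))) `
    (SIGMA k:{..<n}. {h (int k + 1)<..h (int k)})"
  note defs = top_def bottom_def left_def right_def
  have h_nonneg: "0 \<le> h x" for x by (simp add: h_def column_height_def)
  have row_pos: "1 \<le> y" if "h x < y" for x y using h_nonneg[of x] that by linarith
  have eq: "{(c, d). c \<in> motzkin_polyomino w \<and> adjacent c d \<and> d \<notin> motzkin_polyomino w}
    = top \<union> bottom \<union> left \<union> right" (is "?E = _")
  proof (intro equalityI subsetI)
    fix e assume "e \<in> ?E"
    then obtain x y d where e: "e = ((x, y), d)" and y: "1 \<le> y" "y \<le> h x"
      and adj: "adjacent (x, y) d" and out: "d \<notin> motzkin_polyomino w"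
      by (auto simp: polyomino_column_height h_def)
    obtain k where k: "k < n" "x = int k" using h_range[of x] y by auto
    from adj consider "d = (x, y + 1)" | "d = (x, y - 1)" | "d = (x - 1, y)" | "d = (x + 1, y)"
      by (auto simp: adjacent_iff)
    then show "e \<in> top \<union> bottom \<union> left \<union> right"
    proof cases
      case 1
      then have "y = h x" using out y by (auto simp: polyomino_column_height h_def)
      then have "e \<in> top" using k e 1 by (auto simp: top_def)
      then show ?thesis by simp
    next
      case 2
      then have "y = 1" using out y by (auto simp: polyomino_column_height h_def)
      then have "e \<in> bottom" using k e 2 by (auto simp: bottom_def)
      then show ?thesis by simp
    next
      case 3
      then have "h (x - 1) < y" using out y by (auto simp: polyomino_column_height h_def)
      then have "e \<in> left" using k e 3 y by (force simp: left_def)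
      then show ?thesis by simp
    next
      case 4
      then have "h (x + 1) < y" using out y by (auto simp: polyomino_column_height h_def)
      then have "e \<in> right" using k e 4 y by (force simp: right_def)
      then show ?thesis by simp
    qed
  next
    fix e assume "e \<in> top \<union> bottom \<union> left \<union> right"
    then show "e \<in> ?E"
      using h_pos
      by (auto simp: defs adjacent_iff polyomino_column_height h_def[symmetric] intro: row_pos)
  qed
  have "card top = n" unfolding top_def by (subst card_image) (auto simp: inj_on_def)
  moreover have "card bottom = n" unfolding bottom_def by (subst card_image) (auto simp: inj_on_def)
  moreover have "card left = (\<Sum>k<n. g (Suc k) - g k)"
    unfolding left_def by (subst card_image) (auto simp: inj_on_def hg hg_left nat_diff_distrib' intro!: sum.cong)
  moreover have "card right = (\<Sum>k<n. g (Suc k) - g (Suc (Suc k)))"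
    unfolding right_def by (subst card_image) (auto simp: inj_on_def hg hg_right nat_diff_distrib' intro!: sum.cong)
  moreover have "card (top \<union> bottom \<union> left \<union> right) = card top + card bottom + card left + card right"
    by (subst card_Un_disjoint; (force simp: defs)?)+
  moreover have "(\<Sum>k<n. g (Suc k) - g k) = ascent_sum 0 w"
    by (auto simp: ascent_sum_eq_sum n_def g_def nth_append nth_Cons' intro!: sum.cong)
  moreover have "(\<Sum>k<n. g (Suc k) - g (Suc (Suc k))) = (\<Sum>k<n. g (Suc k) - g k)"
  proof -
    have ends: "g 0 = 0" "g (Suc n) = 0" by (auto simp: g_def n_def nth_append)
    show ?thesis
      using sum_ascents_eq_sum_descents[of g "Suc n"] ends
        sum.lessThan_Suc_shift[of "\<lambda>k. g k - g (Suc k)" n] by simp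
  qed
  ultimately show ?thesis
    unfolding perimeter_def eq by (simp add: n_def)
qed

section \<open>First-return decomposition of Motzkin words\<close>

definition motzkin_step :: "nat \<Rightarrow> nat \<Rightarrow> bool" where
  "motzkin_step a b \<longleftrightarrow> 1 \<le> b \<and> b \<le> a + 1 \<and> a \<noteq> b"

lemma motzkin_words_iff:
  "w \<in> motzkin_words n \<longleftrightarrow>
    length w = n \<and> w \<noteq> [] \<and> hd w = 1 \<and> successively motzkin_step w"
proof -
  have "(\<forall>k\<in>{1..<length w}. 1 \<le> w ! k \<and> w ! k \<le> w ! (k - 1) + 1 \<and> w ! (k - 1) \<noteq> w ! k)
    \<longleftrightarrow> (\<forall>i. Suc i < length w \<longrightarrow> motzkin_step (w ! i) (w ! Suc i))" (is "?l \<longleftrightarrow> ?r")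
  proof
    assume ?l
    show ?r
    proof (intro allI impI)
      fix i assume "Suc i < length w"
      then show "motzkin_step (w ! i) (w ! Suc i)"
        using \<open>?l\<close>[rule_format, of "Suc i"] by (simp add: motzkin_step_def)
    qed
  next
    assume r: ?r
    show ?l
    proof
      fix k assume k: "k \<in> {1..<length w}"
      show "1 \<le> w ! k \<and> w ! k \<le> w ! (k - 1) + 1 \<and> w ! (k - 1) \<noteq> w ! k"
        using r[rule_format, of "k - 1"] k by (auto simp: motzkin_step_def)
    qed
  qed
  moreover have "hd w = w ! 0" if "w \<noteq> []" using that by (rule hd_conv_nth)
  ultimately show ?thesis
    unfolding motzkin_words_def successively_conv_nth mem_Collect_eq by metis
qed

lemma successively_motzkin_step_map_Suc:
  assumes "\<forall>x\<in>set u. 1 \<le> x"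
  shows "successively motzkin_step (map Suc u) \<longleftrightarrow> successively motzkin_step u"
  using assms by (induction u rule: induct_list012) (simp_all add: motzkin_step_def)

lemma motzkin_word_letters_pos:
  assumes "successively motzkin_step (a # w)" shows "\<forall>x\<in>set w. 1 \<le> x"
  using assms
proof (induction w arbitrary: a)
  case (Cons b w)
  from Cons.prems have "1 \<le> b" "successively motzkin_step (b # w)"
    by (simp_all add: motzkin_step_def)
  then show ?case using Cons.IH by simp
qed simp

lemma motzkin_words_pos:
  assumes "w \<in> motzkin_words n" shows "\<forall>x\<in>set w. 1 \<le> x"
  using assms motzkin_word_letters_pos[of 1 "tl w"] by (cases w) (simp_all add: motzkin_words_iff)

text \<open>
  First-return decomposition. After the initial 1 the letters before the next 1 form \<open>map Suc u\<close>,
  and the letters from that 1 on form \<open>v\<close>. If the word has more than one letter, then its second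
  letter is 2, so \<open>u\<close> is a Motzkin word and not empty. Conversely, the last letter of \<open>map Suc u\<close>
  is at least 2, so that a descent to the initial 1 of \<open>v\<close> is always possible. No Motzkin word has
  length 0, hence the indices \<open>i = 0\<close> and \<open>i = n\<close> of the union contribute nothing.
\<close>

lemma motzkin_words_Suc:
  "motzkin_words (Suc n) =
     (if n = 0 then {[1]} else {}) \<union>
     (\<lambda>u. 1 # map Suc u) ` motzkin_words n \<union>
     (\<lambda>(u, v). 1 # map Suc u @ v) `
       (\<Union>i\<le>n. motzkin_words i \<times> motzkin_words (n - i))" (is "_ = ?R")
proof (intro equalityI subsetI)
  fix w assume w: "w \<in> motzkin_words (Suc n)"
  then obtain t where t: "w = 1 # t" "length t = n" "successively motzkin_step (1 # t)"
    by (cases w) (auto simp: motzkin_words_iff)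
  show "w \<in> ?R"
  proof (cases t)
    case Nil
    then show ?thesis using t by auto
  next
    case (Cons b t')
    have b: "b = 2" using t Cons by (auto simp: motzkin_step_def)
    define u' where "u' = takeWhile (\<lambda>x. x \<noteq> 1) t"
    define v where "v = dropWhile (\<lambda>x. x \<noteq> 1) t"
    define u where "u = map (\<lambda>x. x - 1) u'"
    have uv: "t = u' @ v" by (simp add: u'_def v_def)
    have pos: "\<forall>x\<in>set t. 1 \<le> x" using motzkin_word_letters_pos t by blast
    have u'_ge: "\<forall>x\<in>set u'. 2 \<le> x"
    proof
      fix x assume "x \<in> set u'"
      then have "x \<noteq> 1" "x \<in> set t" by (auto simp: u'_def dest: set_takeWhileD)
      then show "2 \<le> x" using pos by force
    qed
    have u': "u' = map Suc u"
      unfolding u_def map_map by (rule map_idI[symmetric]) (use u'_ge in force)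
    have u_pos: "\<forall>x\<in>set u. 1 \<le> x" unfolding u_def using u'_ge by force
    have u_hd: "u \<noteq> []" "hd u = 1" using Cons b by (auto simp: u_def u'_def)
    have succ: "successively motzkin_step t" using t Cons by auto
    have u_mem: "u \<in> motzkin_words (length u)"
      using succ u_hd successively_motzkin_step_map_Suc[OF u_pos]
      by (auto simp: motzkin_words_iff uv successively_append_iff u')
    show ?thesis
    proof (cases "v = []")
      case True
      then show ?thesis using t u_mem uv u' by auto
    next
      case False
      have "hd v = 1" using hd_dropWhile[of "\<lambda>x. x \<noteq> 1" t] False by (auto simp: v_def)
      then have "v \<in> motzkin_words (n - length u)"
        using False succ t(2) by (auto simp: motzkin_words_iff uv successively_append_iff u')
      moreover have "length u \<le> n" using t uv u' by auto
      ultimately show ?thesis using u_mem t uv u' by force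
    qed
  qed
next
  fix w assume "w \<in> ?R"
  then consider "n = 0" "w = [1]"
    | u where "u \<in> motzkin_words n" "w = 1 # map Suc u"
    | u v i where "u \<in> motzkin_words i" "v \<in> motzkin_words (n - i)" "i \<le> n" "w = 1 # map Suc u @ v"
    by (auto split: if_splits)
  then show "w \<in> motzkin_words (Suc n)"
  proof cases
    case 1
    then show ?thesis by (auto simp: motzkin_words_iff)
  next
    case (2 u)
    then show ?thesis
      using successively_motzkin_step_map_Suc[OF motzkin_words_pos[OF 2(1)]]
      by (cases u) (auto simp: motzkin_words_iff motzkin_step_def)
  next
    case (3 u v i)
    have "successively motzkin_step (map Suc u)"
      using successively_motzkin_step_map_Suc[OF motzkin_words_pos[OF 3(1)]] 3
      by (auto simp: motzkin_words_iff)
    moreover have "last (map Suc u) \<ge> 2" if "u \<noteq> []"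
      using motzkin_words_pos[OF 3(1)] that by (auto simp: last_map)
    ultimately show ?thesis using 3
      by (auto simp: motzkin_words_iff successively_append_iff successively_Cons motzkin_step_def hd_map)
  qed
qed

lemma finite_motzkin_words: "finite (motzkin_words n)"
proof (induction n rule: less_induct)
  case (less n)
  show ?case
  proof (cases n)
    case 0
    then show ?thesis by (auto simp: motzkin_words_def)
  next
    case (Suc m)
    have 0: "motzkin_words 0 = {}" by (auto simp: motzkin_words_def)
    show ?thesis using less.IH unfolding Suc motzkin_words_Suc
      by (auto intro!: finite_imageI finite_UN_I finite_cartesian_product)
  qed
qed

text \<open>
  All letters of the raised part exceed 1, so \<open>v\<close> starts at the first letter 1. Allowing \<open>v\<close> to
  be empty also separates words with two parts from words with one.
\<close>

lemma motzkin_decomposition_inj: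
  assumes "\<forall>x\<in>set u. 1 \<le> x" "\<forall>x\<in>set u'. 1 \<le> x"
    and "v = [] \<or> hd v = 1" "v' = [] \<or> hd v' = 1"
    and "map Suc u @ v = map Suc u' @ v'"
  shows "u = u' \<and> v = v'"
proof -
  have *: "takeWhile (\<lambda>x. x \<noteq> 1) (map Suc u @ v) = map Suc u"
    if "\<forall>x\<in>set u. 1 \<le> x" "v = [] \<or> hd v = 1" for u v
  proof -
    have "takeWhile (\<lambda>x. x \<noteq> 1) (map Suc u @ v) = map Suc u @ takeWhile (\<lambda>x. x \<noteq> 1) v"
      by (rule takeWhile_append2) (use that in force)
    then show ?thesis using that by (cases v) simp_all
  qed
  have "map Suc u = map Suc u'" using *[of u v] *[of u' v'] assms by metis
  then show ?thesis using assms(5) by (auto simp: inj_map_eq_map)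
qed

text \<open>
  Stated for an arbitrary weight, because the same recursion is needed with weight 1, for the number
  of words, and with the semiperimeter.
\<close>

lemma sum_motzkin_words_Suc:
  fixes f :: "nat list \<Rightarrow> real"
  shows "(\<Sum>w\<in>motzkin_words (Suc n). f w) =
     (if n = 0 then f [1] else 0) +
     (\<Sum>u\<in>motzkin_words n. f (1 # map Suc u)) +
     (\<Sum>i\<le>n. \<Sum>u\<in>motzkin_words i. \<Sum>v\<in>motzkin_words (n - i). f (1 # map Suc u @ v))"
proof -
  define A where "A = (if n = 0 then {[1::nat]} else {})"
  define B where "B = (\<lambda>u. 1 # map Suc u) ` motzkin_words n"
  define D where "D = (\<Union>i\<le>n. motzkin_words i \<times> motzkin_words (n - i))"
  define C where "C = (\<lambda>(u, v). 1 # map Suc u @ v) ` D"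
  have nonempty: "w \<noteq> []" "hd w = 1" if "w \<in> motzkin_words m" for w m
    using that by (auto simp: motzkin_words_iff)
  have finD: "finite D" unfolding D_def using finite_motzkin_words by auto
  have injB: "inj_on (\<lambda>u. 1 # map Suc u) (motzkin_words n)" by (auto simp: inj_on_def inj_map_eq_map)
  have injC: "inj_on (\<lambda>(u, v). 1 # map Suc u @ v) D"
  proof -
    have "u = u' \<and> v = v'" if "(u, v) \<in> D" "(u', v') \<in> D"
      and eq: "map Suc u @ v = map Suc u' @ v'" for u v u' v'
    proof -
      from that obtain i i' where "u \<in> motzkin_words i" "v \<in> motzkin_words (n - i)"
        "u' \<in> motzkin_words i'" "v' \<in> motzkin_words (n - i')" by (auto simp: D_def)
      then show ?thesis
        using motzkin_decomposition_inj[of u u' v v'] motzkin_words_pos nonempty eq by blast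
    qed
    then show ?thesis by (fastforce simp: inj_on_def)
  qed
  have AB: "A \<inter> B = {}" by (auto simp: A_def B_def dest: nonempty)
  have BC: "(A \<union> B) \<inter> C = {}"
  proof -
    have "map Suc u \<noteq> map Suc u' @ v" if "u \<in> motzkin_words n"
      "u' \<in> motzkin_words i" "v \<in> motzkin_words j" for u u' v i j
      using motzkin_decomposition_inj[of u u' "[]" v] motzkin_words_pos[OF that(1)]
        motzkin_words_pos[OF that(2)] nonempty[OF that(3)] by auto
    then have "B \<inter> C = {}" by (auto simp: B_def C_def D_def)
    moreover have "A \<inter> C = {}" by (auto simp: A_def C_def D_def dest: nonempty)
    ultimately show ?thesis by blast
  qed
  have fin: "finite A" "finite B" "finite C"
    using finD by (simp_all add: A_def B_def C_def finite_motzkin_words)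
  have "(\<Sum>w\<in>motzkin_words (Suc n). f w) = sum f A + sum f B + sum f C"
    unfolding motzkin_words_Suc A_def[symmetric] B_def[symmetric] C_def[symmetric] D_def[symmetric]
    using sum.union_disjoint[OF _ _ AB, of f] sum.union_disjoint[OF _ _ BC, of f] fin by simp
  moreover have "sum f A = (if n = 0 then f [1] else 0)" by (auto simp: A_def)
  moreover have "sum f B = (\<Sum>u\<in>motzkin_words n. f (1 # map Suc u))"
    unfolding B_def by (subst sum.reindex[OF injB]) simp
  moreover have "sum f C = (\<Sum>(u, v)\<in>D. f (1 # map Suc u @ v))"
    unfolding C_def by (subst sum.reindex[OF injC]) (simp add: case_prod_unfold)
  moreover have "\<dots> = (\<Sum>i\<le>n. \<Sum>(u, v)\<in>motzkin_words i \<times> motzkin_words (n - i). f (1 # map Suc u @ v))"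
    unfolding D_def by (rule sum.UNION_disjoint)
      (auto simp: finite_motzkin_words, auto simp: motzkin_words_iff)
  ultimately show ?thesis by (simp add: sum.cartesian_product)
qed

section \<open>Semiperimeters of the decomposed words\<close>

lemma ascent_sum_append:
  "ascent_sum p (u @ v) = ascent_sum p u + ascent_sum (last (p # u)) v"
  by (induction u arbitrary: p) auto

lemma ascent_sum_map_Suc: "ascent_sum (Suc p) (map Suc u) = ascent_sum p u"
  by (induction u arbitrary: p) auto

lemma sper_motzkin_word:
  assumes "w \<in> motzkin_words n"
  shows "sper w = real (length w + ascent_sum 0 w)"
  using perimeter_eq[OF motzkin_words_pos[OF assms]] by (simp add: sper_def)

text \<open>
  One more column, and one more ascent from 0 to the new initial 1.
\<close>

lemma sper_raise:
  assumes "u \<in> motzkin_words n"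
  shows "sper (1 # map Suc u) = sper u + 2"
proof -
  have "1 # map Suc u \<in> motzkin_words (Suc n)" using assms by (auto simp: motzkin_words_Suc)
  then show ?thesis using ascent_sum_map_Suc[of 0 u] assms by (simp add: sper_motzkin_word)
qed

text \<open>
  There is one more column than in \<open>u\<close> and \<open>v\<close> together. The ascent to the new initial 1 is
  compensated by the lost ascent from 0 to the first letter of \<open>v\<close>, which now comes after a
  descent.
\<close>

lemma sper_join:
  assumes u: "u \<in> motzkin_words i" and v: "v \<in> motzkin_words j"
  shows "sper (1 # map Suc u @ v) = sper u + sper v + 1"
proof -
  have mem: "1 # map Suc u @ v \<in> motzkin_words (Suc (i + j))"
    unfolding motzkin_words_Suc using u v
    by (intro UnI2 image_eqI[where x = "(u, v)"] UN_I[where a = i]) auto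
  have "2 \<le> last (map Suc u)"
    using u motzkin_words_pos[OF u] by (auto simp: motzkin_words_iff last_map)
  moreover obtain v' where "v = 1 # v'" using v by (cases v) (auto simp: motzkin_words_iff)
  moreover have "u \<noteq> []" using u by (auto simp: motzkin_words_iff)
  ultimately show ?thesis
    using ascent_sum_map_Suc[of 0 u]
    unfolding sper_motzkin_word[OF mem] sper_motzkin_word[OF u] sper_motzkin_word[OF v]
    by (simp add: ascent_sum_append)
qed

lemma sper_singleton: "sper [1] = 2"
proof -
  have "[1] \<in> motzkin_words (Suc 0)" by (simp add: motzkin_words_def)
  then show ?thesis by (simp add: sper_motzkin_word del: One_nat_def)
qed

section \<open>Generating functions of Motzkin words\<close>

definition motzkin_word_fps :: "real fps" where
  "motzkin_word_fps = Abs_fps (\<lambda>n. real (card (motzkin_words n)))"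

definition sper_fps :: "real fps" where
  "sper_fps = Abs_fps total_sper"

lemma motzkin_words_0: "motzkin_words 0 = {}"
  by (simp add: motzkin_words_def)

lemma motzkin_word_fps_eq:
  "motzkin_word_fps = fps_X * (1 + motzkin_word_fps + motzkin_word_fps ^ 2)"
proof (rule fps_ext)
  fix n
  show "fps_nth motzkin_word_fps n =
    fps_nth (fps_X * (1 + motzkin_word_fps + motzkin_word_fps ^ 2)) n"
  proof (cases n)
    case 0
    then show ?thesis by (simp add: motzkin_word_fps_def motzkin_words_0)
  next
    case (Suc m)
    have "fps_nth (motzkin_word_fps ^ 2) m =
      (\<Sum>i\<le>m. real (card (motzkin_words i)) * real (card (motzkin_words (m - i))))"
      by (simp add: motzkin_word_fps_def power2_eq_square fps_mult_nth atLeast0AtMost)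
    then show ?thesis
      using sum_motzkin_words_Suc[of "\<lambda>_. 1" m]
      by (simp add: Suc motzkin_word_fps_def)
  qed
qed

lemma sper_fps_eq:
  "sper_fps = fps_X * (2 + sper_fps + 2 * motzkin_word_fps + motzkin_word_fps ^ 2
      + 2 * sper_fps * motzkin_word_fps)"
proof (rule fps_ext)
  fix n
  define a where "a k = real (card (motzkin_words k))" for k
  show "fps_nth sper_fps n = fps_nth (fps_X * (2 + sper_fps + 2 * motzkin_word_fps
      + motzkin_word_fps ^ 2 + 2 * sper_fps * motzkin_word_fps)) n"
  proof (cases n)
    case 0
    then show ?thesis by (simp add: sper_fps_def total_sper_def motzkin_words_0)
  next
    case (Suc m)
    have raise: "(\<Sum>u\<in>motzkin_words m. sper (1 # map Suc u)) = total_sper m + 2 * a m"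
      by (simp add: sper_raise sum.distrib total_sper_def a_def del: One_nat_def)
    have join: "(\<Sum>u\<in>motzkin_words i. \<Sum>v\<in>motzkin_words j. sper (1 # map Suc u @ v)) =
      total_sper i * a j + a i * total_sper j + a i * a j" for i j
      by (simp add: sper_join sum.distrib total_sper_def a_def sum_distrib_right mult.commute
          del: One_nat_def)
    have "total_sper n = (if m = 0 then 2 else 0) + total_sper m + 2 * a m +
      (\<Sum>i\<le>m. total_sper i * a (m - i) + a i * total_sper (m - i) + a i * a (m - i))"
      unfolding Suc total_sper_def[of "Suc m"] sum_motzkin_words_Suc raise join sper_singleton
      by simp
    also have "\<dots> = (if m = 0 then 2 else 0) + total_sper m + 2 * a m +
      fps_nth (sper_fps * motzkin_word_fps) m + fps_nth (motzkin_word_fps * sper_fps) m +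
      fps_nth (motzkin_word_fps ^ 2) m"
      by (simp add: sper_fps_def motzkin_word_fps_def a_def power2_eq_square fps_mult_nth
          atLeast0AtMost sum.distrib)
    also have "\<dots> = fps_nth (fps_const 2 + sper_fps + fps_const 2 * motzkin_word_fps
      + motzkin_word_fps ^ 2 + fps_const 2 * (sper_fps * motzkin_word_fps)) m"
      by (simp add: sper_fps_def motzkin_word_fps_def a_def mult.commute[of "Abs_fps total_sper"])
    finally show ?thesis by (simp add: Suc sper_fps_def fps_numeral_fps_const mult.assoc)
  qed
qed

section \<open>The generating function of the central trinomial coefficients\<close>

abbreviation trinomial_coeff :: "nat \<Rightarrow> nat \<Rightarrow> nat" where
  "trinomial_coeff n k \<equiv> coeff ([:1, 1, 1:] ^ n) k"

text \<open>
  The polynomial \<open>1 + x + x\<^sup>2\<close> is palindromic, hence so are its powers.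
\<close>

lemma trinomial_coeff_symmetric:
  assumes "k \<le> n"
  shows "trinomial_coeff n (n - k) = trinomial_coeff n (n + k)"
proof -
  have deg: "degree (([:1, 1, 1:] :: nat poly) ^ n) = 2 * n"
    by (induction n) (simp_all add: degree_mult_eq del: mult_pCons_left)
  have "reflect_poly ([:1, 1, 1:] :: nat poly) = [:1, 1, 1:]"
    by (simp add: reflect_poly_def)
  then have "reflect_poly (([:1, 1, 1:] :: nat poly) ^ n) = [:1, 1, 1:] ^ n"
    by (simp add: reflect_poly_power)
  then show ?thesis
    using coeff_reflect_poly[of "([:1, 1, 1:] :: nat poly) ^ n" "n - k"] assms
    by (simp add: deg del: One_nat_def)
qed

lemma trinomial_coeff_Suc:
  "trinomial_coeff (Suc n) (Suc (Suc k)) =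
     trinomial_coeff n (Suc (Suc k)) + trinomial_coeff n (Suc k) + trinomial_coeff n k"
  by (simp add: coeff_pCons split: nat.split)

text \<open>
  The coefficients of \<open>((1 + x + x\<^sup>2)\<^sup>n\<^sup>+\<^sup>1)' = (n + 1) (1 + x + x\<^sup>2)\<^sup>n (1 + 2 x)\<close>.
\<close>

lemma trinomial_coeff_derivative:
  "Suc k * trinomial_coeff (Suc n) (Suc k) =
     Suc n * (trinomial_coeff n k + 2 * (if k = 0 then 0 else trinomial_coeff n (k - 1)))"
proof -
  have "coeff (pderiv (([:1, 1, 1:] :: nat poly) ^ Suc n)) k =
    coeff (smult (of_nat (Suc n)) ([:1, 1, 1:] ^ n) * pderiv [:1, 1, 1:]) k"
    by (simp only: pderiv_power_Suc)
  then show ?thesis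
    by (cases k) (simp_all add: coeff_pderiv pderiv_pCons algebra_simps del: power_Suc)
qed

lemma central_trinomial_Suc:
  "central_trinomial (Suc n) = central_trinomial n + 2 * trinomial_coeff n (Suc n)"
proof (cases n)
  case 0
  then show ?thesis by (simp add: central_trinomial_def)
next
  case (Suc m)
  then show ?thesis
    using trinomial_coeff_Suc[of n m] trinomial_coeff_symmetric[of 1 n]
    by (simp add: central_trinomial_def del: power_Suc)
qed

lemma side_trinomial_Suc:
  "(n + 2) * trinomial_coeff (Suc n) (Suc (Suc n)) =
     Suc n * (2 * central_trinomial n + trinomial_coeff n (Suc n))"
proof -
  have "(n + 2) * trinomial_coeff (Suc n) (Suc (Suc n)) =
    Suc n * (trinomial_coeff n (Suc n) + 2 * trinomial_coeff n n)"
    using trinomial_coeff_derivative[of "Suc n" n] by (simp del: power_Suc)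
  then show ?thesis by (simp add: central_trinomial_def algebra_simps)
qed

text \<open>
  The two preceding lemmas are a linear system for the central coefficients and their right
  neighbours \<open>u\<close>; the recurrence results from eliminating \<open>u\<close>.
\<close>

lemma central_trinomial_recurrence:
  "(n + 2) * central_trinomial (n + 2) =
     (2 * n + 3) * central_trinomial (n + 1) + 3 * (n + 1) * central_trinomial n"
proof -
  define u where "u k = trinomial_coeff k (Suc k)" for k
  have 1: "central_trinomial (n + 2) = central_trinomial (n + 1) + 2 * u (Suc n)"
    and 2: "central_trinomial (n + 1) = central_trinomial n + 2 * u n"
    using central_trinomial_Suc[of "n + 1"] central_trinomial_Suc[of n] by (simp_all add: u_def)
  have 3: "(n + 2) * u (Suc n) = (n + 1) * (2 * central_trinomial n + u n)"
    using side_trinomial_Suc[of n] by (simp add: u_def)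
  have "(n + 2) * central_trinomial (n + 2) =
     (n + 2) * central_trinomial (n + 1) + 2 * ((n + 2) * u (Suc n))"
    unfolding 1 by (simp only: algebra_simps)
  also have "\<dots> = (2 * n + 3) * central_trinomial (n + 1) + 3 * (n + 1) * central_trinomial n"
    unfolding 3 2 by (simp add: algebra_simps)
  finally show ?thesis .
qed

definition central_trinomial_fps :: "real fps" where
  "central_trinomial_fps = Abs_fps (\<lambda>n. real (central_trinomial n))"

lemma central_trinomial_0: "central_trinomial 0 = 1"
  by (simp add: central_trinomial_def)

lemma central_trinomial_1: "central_trinomial (Suc 0) = 1"
  by (simp add: central_trinomial_def)

text \<open>
  The coefficients of \<open>x\<^sup>n\<^sup>+\<^sup>1\<close> agree by \<open>central_trinomial_recurrence\<close>, and the constant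
  coefficients because the central trinomial coefficients at 0 and 1 are equal.
\<close>

lemma central_trinomial_fps_ode:
  "fps_deriv central_trinomial_fps * (1 - 2 * fps_X - 3 * fps_X ^ 2) =
     (1 + 3 * fps_X) * central_trinomial_fps"
proof -
  have r: "real (n + 2) * real (central_trinomial (n + 2)) =
     real (2 * n + 3) * real (central_trinomial (n + 1)) + 3 * real (n + 1) * real (central_trinomial n)" for n
    using arg_cong[OF central_trinomial_recurrence[of n], of real]
    by (simp only: of_nat_mult of_nat_add of_nat_numeral)
  \<comment> \<open>Both sides in a form whose coefficients the simplifier can read off as shifts.\<close>
  have eq: "fps_deriv T * (1 - 2 * fps_X - 3 * fps_X ^ 2) =
     fps_deriv T - fps_X * (fps_const 2 * fps_deriv T) - fps_X * (fps_X * (fps_const 3 * fps_deriv T))"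
    "(1 + 3 * fps_X) * T = T + fps_X * (fps_const 3 * T)" for T :: "real fps"
    by (simp_all add: algebra_simps power2_eq_square fps_numeral_fps_const)
  show ?thesis
    unfolding eq
  proof (rule fps_ext)
    fix n
    show "fps_nth (fps_deriv central_trinomial_fps - fps_X * (fps_const 2 * fps_deriv central_trinomial_fps) -
        fps_X * (fps_X * (fps_const 3 * fps_deriv central_trinomial_fps))) n =
      fps_nth (central_trinomial_fps + fps_X * (fps_const 3 * central_trinomial_fps)) n"
    proof (cases n)
      case 0
      then show ?thesis
        by (simp add: central_trinomial_fps_def central_trinomial_0 central_trinomial_1)
    next
      case (Suc m)
      then show ?thesis using r[of m]
        by (cases m) (simp_all add: central_trinomial_fps_def algebra_simps)
    qed
  qed
qed

text \<open>
  With \<open>D = 1 - 2 x - 3 x\<^sup>2\<close> one has \<open>D' = - 2 (1 + 3 x)\<close>, so that the differential equation makes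
  the derivative \<open>2 T T' D + T\<^sup>2 D'\<close> of \<open>T\<^sup>2 D\<close> vanish. The constant term is 1.
\<close>

lemma central_trinomial_fps_square:
  "central_trinomial_fps ^ 2 * (1 - 2 * fps_X - 3 * fps_X ^ 2) = 1"
proof -
  define T where "T = central_trinomial_fps"
  define D where "D = (1 - 2 * fps_X - 3 * fps_X ^ 2 :: real fps)"
  have ode: "fps_deriv T * D = (1 + 3 * fps_X) * T"
    using central_trinomial_fps_ode by (simp add: T_def D_def)
  have D': "fps_deriv D = - 2 * (1 + 3 * fps_X)"
    by (simp add: D_def power2_eq_square algebra_simps)
  have "fps_deriv (T ^ 2 * D) = 2 * T * (fps_deriv T * D) + T ^ 2 * fps_deriv D"
    by (simp add: power2_eq_square algebra_simps)
  also have "\<dots> = 0" unfolding ode D' by (simp add: power2_eq_square algebra_simps)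
  finally have "T ^ 2 * D = fps_const (fps_nth (T ^ 2 * D) 0)"
    by (simp only: fps_deriv_eq_0_iff)
  also have "fps_nth (T ^ 2 * D) 0 = 1"
    by (simp add: T_def D_def central_trinomial_fps_def central_trinomial_0 power2_eq_square)
  finally show ?thesis by (simp add: T_def D_def)
qed

section \<open>Square roots and closed forms\<close>

text \<open>
  Series over the reals have no zero divisors, and equal constant terms 1 exclude opposite signs.
  In this way square roots are identified by their squares.
\<close>

lemma fps_eq_if_squares_eq:
  fixes f g :: "real fps"
  assumes "f ^ 2 = g ^ 2" "fps_nth f 0 = 1" "fps_nth g 0 = 1"
  shows "f = g"
proof -
  have "f \<noteq> - g" using assms(2,3) by force
  then show ?thesis using assms(1) by (simp add: power2_eq_iff)
qed

text \<open>
  This is the discriminant root of the quadratic equation for \<open>motzkin_word_fps\<close>; defining it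
  through the word series keeps everything in terms of power series with known coefficients.
\<close>

definition motzkin_root :: "real fps" where
  "motzkin_root = 1 - fps_X - 2 * fps_X * motzkin_word_fps"

lemma motzkin_root_square: "motzkin_root ^ 2 = 1 - 2 * fps_X - 3 * fps_X ^ 2"
  unfolding motzkin_root_def using motzkin_word_fps_eq by algebra

lemma motzkin_root_0: "fps_nth motzkin_root 0 = 1"
  by (simp add: motzkin_root_def)

lemma motzkin_root_eq_radical:
  "fps_radical root 2 (1 - 2 * fps_X - 3 * fps_X ^ 2) = motzkin_root"
proof (rule fps_eq_if_squares_eq)
  show "fps_radical root 2 (1 - 2 * fps_X - 3 * fps_X ^ 2) ^ 2 = motzkin_root ^ 2"
    using power_radical[of "1 - 2 * fps_X - 3 * fps_X ^ 2 :: real fps" root 1]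
    by (simp add: motzkin_root_square numeral_2_eq_2[symmetric])
qed (simp_all add: motzkin_root_0)

text \<open>
  The numerator of the defining fraction is \<open>1 - x - R = 2 x M\<close>, and \<open>M\<close> has constant term 0.
  Hence the fraction is \<open>M / x\<close>, which is where the shift of the index comes from.
\<close>

lemma motzkin_number_eq_card: "motzkin_number n = real (card (motzkin_words (Suc n)))"
proof -
  define m where "m = fps_shift 1 motzkin_word_fps"
  have shift: "motzkin_word_fps = fps_X * m"
    by (rule fps_ext) (simp add: m_def motzkin_word_fps_def motzkin_words_0)
  have "1 - fps_X - motzkin_root = 2 * fps_X ^ 2 * m"
    by (simp add: motzkin_root_def shift power2_eq_square algebra_simps)
  then have "(1 - fps_X - motzkin_root) / (2 * fps_X ^ 2) = m" by simp
  then show ?thesis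
    unfolding motzkin_number_def motzkin_root_eq_radical
    by (simp add: m_def motzkin_word_fps_def)
qed

lemma central_trinomial_fps_mult_root: "central_trinomial_fps * motzkin_root = 1"
proof (rule fps_eq_if_squares_eq)
  show "(central_trinomial_fps * motzkin_root) ^ 2 = 1 ^ 2"
    using central_trinomial_fps_square by (simp add: power_mult_distrib motzkin_root_square)
qed (simp_all add: motzkin_root_0 central_trinomial_fps_def central_trinomial_0)

text \<open>
  The functional equation for \<open>S\<close> reads \<open>S (1 - x - 2 x M) = x + x M + x (1 + M + M\<^sup>2)\<close>, and the
  last summand is \<open>M\<close>. The right-hand side is then rewritten so that it turns into the claimed
  combination when multiplied by \<open>T = 1 / R\<close>.
\<close>

lemma sper_fps_closed_form:
  "sper_fps = central_trinomial_fps - 1 + 2 * fps_X * central_trinomial_fps - motzkin_word_fps"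
proof -
  define M where "M = motzkin_word_fps"
  define S where "S = sper_fps"
  define T where "T = central_trinomial_fps"
  define R where "R = motzkin_root"
  have M: "M = fps_X * (1 + M + M ^ 2)"
    and S: "S = fps_X * (2 + S + 2 * M + M ^ 2 + 2 * S * M)"
    using motzkin_word_fps_eq sper_fps_eq by (simp_all only: M_def S_def)
  have R: "R = 1 - fps_X - 2 * fps_X * M" by (simp only: R_def motzkin_root_def M_def)
  have TR: "T * R = 1" by (simp only: T_def R_def central_trinomial_fps_mult_root)
  have "S * R = M + fps_X + fps_X * M" using M S R by algebra
  moreover have "M + fps_X + fps_X * M = 1 - R + 2 * fps_X - M * R" using M R by algebra
  ultimately have "S = T - 1 + 2 * fps_X * T - M" using TR by algebra
  then show ?thesis by (simp only: M_def S_def T_def)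
qed

theorem corollary4p5:
  fixes n :: nat
  assumes "n \<ge> 1"
  shows "total_sper n =
    real (central_trinomial n) + 2 * real (central_trinomial (n - 1)) - motzkin_number (n - 1)"
proof -
  obtain k where n: "n = Suc k" using assms by (cases n) auto
  have "fps_nth sper_fps n = fps_nth (central_trinomial_fps - 1
      + fps_X * (fps_const 2 * central_trinomial_fps) - motzkin_word_fps) n"
    by (subst sper_fps_closed_form) (simp add: fps_numeral_fps_const algebra_simps)
  then show ?thesis
    by (simp add: n sper_fps_def central_trinomial_fps_def motzkin_word_fps_def
        motzkin_number_eq_card)
qed

end
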